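(* Let $\gamma:\mathbb{R}\to\mathbb{R}$ be a class $\mathcal{K}$ function, let $u^*:\mathbb{R}^3\times SO(3)\to\mathbb{R}^6$ be a nominal control law, and let $\gamma_0,d_m,d_M>0$ be constants with $d_m<1<d_M$. Consider the kinematic rigid body $\dot p=v$, $\dot R=R[\omega]_\times$ with state $x=(p,R)\in\mathbb{R}^3\times SO(3)$ and control input $u=(v,\omega)\in\mathbb{R}^3\times\mathbb{R}^3$. At each time instant let $u$ be the control obtained from a solution $(u,c_1,c_2)$ of the following quadratic program, which is assumed to be feasible: $$ \begin{aligned} \min_{u=(v,\omega)\in\mathbb{R}^6,\; c_1,c_2\in\mathbb{R}}\quad & \|u-u^*(x)\|^2\\ \text{subject to}\quad & -\frac{1}{\hat d}\, e_c^T R^T P_\beta^T v + c_1\,\gamma(h(x))\ \ge 0,\\ & -\beta^T R\,[e_c]_\times\,\omega + c_2\,\gamma(h(x))\ \ge 0,\\ & c_1+c_2=\gamma_0,\\ & \frac{\gamma_0}{1-d_M}< c_2<\frac{\gamma_0}{1-d_m}. \end{aligned} $$ Then this control law renders the set $\mathcal{C}_h=\{x : h(x)\ge 0\}$ forward invariant whenever $\tilde d\in[d_m,d_M]$ (at all times along the trajectory).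
   Context: Setting: $p\in\mathbb{R}^3$ is the position and $R\in SO(3)$ the orientation (body to inertial frame) of an agent; $v$ is its linear velocity in the inertial frame and $\omega$ its angular velocity in the body frame. A unit vector $e_c\in\mathbb{R}^3$ (camera optical axis in the body frame), an angle $\psi_F\in(0,\pi/2)$ and a single fixed feature point $q\in\mathbb{R}^3$ are given. Notation: $[w]_\times$ is the skew-symmetric $3\times 3$ matrix with $[w]_\times y=w\times y$. For $p\ne q$: $d=d(p)=\|q-p\|$ is the distance to the feature, $\beta=\beta(p)=(q-p)/\|q-p\|$ is the bearing, and $P_\beta=I-\beta\beta^T$. The function $\hat d(p,t)$ is a real-valued estimate of $d(p)$, and $\tilde d(p,t)=d(p)/\hat d(p,t)$ is the relative error. The candidate barrier function is $h(x)=\beta(p)^T R e_c-\cos\psi_F$, defined for $p\neq q$. A class $\mathcal{K}$ function is a strictly increasing function $\gamma:\mathbb{R}\to\mathbb{R}$ with $\gamma(0)=0$. Forward invariance of $\mathcal{C}_h$ means: every closed-loop trajectory $x(t)$, $t\ge 0$ (on its interval of existence, with $p(t)\ne q$), with $x(0)\in\mathcal{C}_h$ satisfies $x(t)\in\mathcal{C}_h$ for all $t\ge0$ in that interval. *)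

theory Defs
  imports "HOL-Analysis.Analysis"
begin

(* A state is a pair (p, R); membership of R in SO(3) is carried as rotation_matrix R.
   A control is a pair (v, omega); the product norm on it is the Euclidean norm of R^6. *)
type_synonym state = "(real^3) \<times> (real^3^3)"
type_synonym control = "(real^3) \<times> (real^3)"

definition skew :: "real^3 \<Rightarrow> real^3^3" where
  "skew w = matrix (cross3 w)"

definition feature_dist :: "real^3 \<Rightarrow> real^3 \<Rightarrow> real" where
  "feature_dist q p = norm (q - p)"

definition bearing :: "real^3 \<Rightarrow> real^3 \<Rightarrow> real^3" where
  "bearing q p = (1 / norm (q - p)) *\<^sub>R (q - p)"

definition proj_mat :: "real^3 \<Rightarrow> real^3^3" where
  "proj_mat b = mat 1 - (\<chi> i j. b $ i * b $ j)"

definition rel_error :: "real^3 \<Rightarrow> (real^3 \<Rightarrow> real \<Rightarrow> real) \<Rightarrow> real^3 \<Rightarrow> real \<Rightarrow> real" where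
  "rel_error q dhat p t = feature_dist q p / dhat p t"

definition barrier :: "real^3 \<Rightarrow> real^3 \<Rightarrow> real \<Rightarrow> state \<Rightarrow> real" where
  "barrier q e\<^sub>c \<psi> = (\<lambda>(p, R). bearing q p \<bullet> (R *v e\<^sub>c) - cos \<psi>)"

(* The barrier is meaningful only for p different from q, where the bearing is defined. *)
definition state_space :: "real^3 \<Rightarrow> state set" where
  "state_space q = {(p, R). p \<noteq> q \<and> rotation_matrix R}"

definition safe_set :: "real^3 \<Rightarrow> real^3 \<Rightarrow> real \<Rightarrow> state set" where
  "safe_set q e\<^sub>c \<psi> = {x \<in> state_space q. barrier q e\<^sub>c \<psi> x \<ge> 0}"

(* Extended class K: functions on the whole real line; continuity is not required. *)
definition class_K :: "(real \<Rightarrow> real) \<Rightarrow> bool" where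
  "class_K \<gamma> \<longleftrightarrow> strict_mono \<gamma> \<and> \<gamma> 0 = 0"

definition qp_constraints ::
  "real^3 \<Rightarrow> real^3 \<Rightarrow> real \<Rightarrow> (real \<Rightarrow> real) \<Rightarrow> (real^3 \<Rightarrow> real \<Rightarrow> real) \<Rightarrow> real \<Rightarrow> real \<Rightarrow> real
    \<Rightarrow> state \<Rightarrow> real \<Rightarrow> control \<times> real \<times> real \<Rightarrow> bool" where
  "qp_constraints q e\<^sub>c \<psi> \<gamma> dhat \<gamma>\<^sub>0 d\<^sub>m d\<^sub>M = (\<lambda>(p, R) t ((v, \<omega>), c\<^sub>1, c\<^sub>2).
     - (1 / dhat p t) * (e\<^sub>c \<bullet> (transpose R *v (transpose (proj_mat (bearing q p)) *v v)))
       + c\<^sub>1 * \<gamma> (barrier q e\<^sub>c \<psi> (p, R)) \<ge> 0 \<and>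
     - (bearing q p \<bullet> (R *v (skew e\<^sub>c *v \<omega>))) + c\<^sub>2 * \<gamma> (barrier q e\<^sub>c \<psi> (p, R)) \<ge> 0 \<and>
     c\<^sub>1 + c\<^sub>2 = \<gamma>\<^sub>0 \<and>
     \<gamma>\<^sub>0 / (1 - d\<^sub>M) < c\<^sub>2 \<and> c\<^sub>2 < \<gamma>\<^sub>0 / (1 - d\<^sub>m))"

definition qp_solution ::
  "real^3 \<Rightarrow> real^3 \<Rightarrow> real \<Rightarrow> (real \<Rightarrow> real) \<Rightarrow> (real^3 \<Rightarrow> real \<Rightarrow> real) \<Rightarrow> real \<Rightarrow> real \<Rightarrow> real
    \<Rightarrow> (state \<Rightarrow> control) \<Rightarrow> state \<Rightarrow> real \<Rightarrow> control \<times> real \<times> real \<Rightarrow> bool" where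
  "qp_solution q e\<^sub>c \<psi> \<gamma> dhat \<gamma>\<^sub>0 d\<^sub>m d\<^sub>M ustar x t =
     is_arg_min (\<lambda>(u, c\<^sub>1, c\<^sub>2). (norm (u - ustar x))\<^sup>2) (qp_constraints q e\<^sub>c \<psi> \<gamma> dhat \<gamma>\<^sub>0 d\<^sub>m d\<^sub>M x t)"

(* Classical solutions of p' = v, R' = R [omega]_x on J; at an endpoint of J the derivative is
   one-sided. *)
definition kinematic_trajectory :: "real^3 \<Rightarrow> real set \<Rightarrow> (real \<Rightarrow> state) \<Rightarrow> (real \<Rightarrow> control) \<Rightarrow> bool" where
  "kinematic_trajectory q J x u \<longleftrightarrow>
     is_interval J \<and> 0 \<in> J \<and> J \<subseteq> {0..} \<and>
     (\<forall>t\<in>J. x t \<in> state_space q \<and>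
        ((\<lambda>s. fst (x s)) has_vector_derivative fst (u t)) (at t within J) \<and>
        ((\<lambda>s. snd (x s)) has_vector_derivative (snd (x t) ** skew (snd (u t)))) (at t within J))"

(* The family T lists the admissible trajectories, each with its interval of existence. *)
definition forward_invariant :: "state set \<Rightarrow> (real set \<times> (real \<Rightarrow> state)) set \<Rightarrow> bool" where
  "forward_invariant C T \<longleftrightarrow> (\<forall>(J, x)\<in>T. x 0 \<in> C \<longrightarrow> (\<forall>t\<in>J. x t \<in> C))"

end

theory Submission
  imports Defs
begin

text \<open>
  Along a trajectory, the derivative of \<open>h\<close> is
  \<open>- (1/d) e\<^sub>c\<^sup>T R\<^sup>T P\<^sub>\<beta> v - \<beta>\<^sup>T R [e\<^sub>c]\<^sub>\<times> \<omega>\<close>. Multiplying the first constraint of the program by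
  \<open>dhat/d > 0\<close> and adding the second one bounds it below by \<open>- (c\<^sub>1/r + c\<^sub>2) \<gamma>(h)\<close>, where
  \<open>r = d/dhat\<close> is the relative error. Since \<open>c\<^sub>1 = \<gamma>\<^sub>0 - c\<^sub>2\<close>, the coefficient equals
  \<open>(\<gamma>\<^sub>0 + c\<^sub>2 (r - 1))/r\<close>, and the bounds on \<open>c\<^sub>2\<close> are what makes it positive for all
  \<open>r \<in> [d\<^sub>m, d\<^sub>M]\<close>. So \<open>h\<close> does not decrease while it is negative, and hence cannot become negative.
\<close>

text \<open>If \<open>f b\<close> were negative, \<open>f\<close> would stay negative after its last
  nonnegative time, hence would be nondecreasing from there on and could not end below zero. Asking
  for a derivative only where \<open>f\<close> is negative suits a barrier whose rate is controlled
  only outside the safe set.\<close>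

lemma nonneg_if_nondecreasing_while_negative:
  fixes f :: "real \<Rightarrow> real"
  assumes "a \<le> b" and cont: "continuous_on {a..b} f" and fa: "f a \<ge> 0"
    and deriv: "\<And>t. a < t \<Longrightarrow> t < b \<Longrightarrow> f t < 0 \<Longrightarrow> \<exists>D\<ge>0. (f has_real_derivative D) (at t)"
  shows "f b \<ge> 0"
proof (rule ccontr)
  assume neg: "\<not> f b \<ge> 0"
  let ?S = "{a..b} \<inter> f -` {0..}"
  have "closed ?S" by (intro continuous_closed_preimage cont) auto
  moreover have "bounded ?S" by (rule bounded_subset[OF bounded_closed_interval[of a b]]) auto
  ultimately have "compact ?S" by (simp add: compact_eq_bounded_closed)
  moreover have "?S \<noteq> {}" using assms(1) fa by auto
  \<comment> \<open>\<open>s\<close> is the last time in the interval at which \<open>f\<close> is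
    nonnegative; compactness makes it attained.\<close>
  ultimately obtain s where s: "s \<in> ?S" and max: "\<And>t. t \<in> ?S \<Longrightarrow> t \<le> s"
    using compact_attains_sup[of ?S] by blast
  have "s < b" using s neg by (cases "s = b") auto
  have "f s \<le> f b"
  proof (rule DERIV_nonneg_imp_increasing_open[of s b f])
    show "s \<le> b" using \<open>s < b\<close> by simp
  next
    show "continuous_on {s..b} f" using cont s by (auto intro: continuous_on_subset)
  next
    fix t assume t: "s < t" "t < b"
    have "f t < 0" using max[of t] t s by fastforce
    then show "\<exists>D. (f has_real_derivative D) (at t) \<and> D \<ge> 0" using deriv[of t] t s by auto
  qed
  then show False using s neg by auto
qed

lemma proj_mat_mult_vec: "proj_mat b *v v = v - (b \<bullet> v) *\<^sub>R b"
proof -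
  have "(\<chi> i j. b $ i * b $ j) *v v = (b \<bullet> v) *\<^sub>R b"
    unfolding vec_eq_iff by (simp add: matrix_vector_mult_def inner_vec_def sum_3 algebra_simps)
  then show ?thesis by (simp add: proj_mat_def matrix_vector_mult_diff_rdistrib)
qed

lemma transpose_proj_mat: "transpose (proj_mat b) = proj_mat b"
  by (auto simp: proj_mat_def transpose_def vec_eq_iff mat_def)

lemma skew_mult_vec: "skew w *v y = cross3 w y"
proof -
  have "linear (cross3 w)" using bilinear_cross by (simp add: bilinear_def)
  then show ?thesis unfolding skew_def by (rule fun_cong[OF matrix_vector_mul(2)])
qed

text \<open>The quotient rule is applied to (w . y)/|w| with w = q - p and y = R e. The result is
  then regrouped into a translational and a rotational term, in exactly the shape of the two program
  constraints.\<close>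

lemma barrier_has_derivative:
  assumes "fst (x t) \<noteq> q"
    and p: "((\<lambda>s. fst (x s)) has_vector_derivative v) (at t within J)"
    and R: "((\<lambda>s. snd (x s)) has_vector_derivative (snd (x t) ** skew \<omega>)) (at t within J)"
  shows "((\<lambda>s. barrier q e \<psi> (x s)) has_real_derivative
      - (1 / feature_dist q (fst (x t)))
          * (e \<bullet> (transpose (snd (x t)) *v (transpose (proj_mat (bearing q (fst (x t)))) *v v)))
      - bearing q (fst (x t)) \<bullet> (snd (x t) *v (skew e *v \<omega>))) (at t within J)"
proof -
  let ?w = "\<lambda>s. q - fst (x s)" and ?y = "\<lambda>s. snd (x s) *v e"
  let ?R = "snd (x t)" and ?n = "norm (q - fst (x t))"
  let ?y' = "- (?R *v (skew e *v \<omega>))"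
  have n: "?n > 0" using assms(1) by simp
  have w': "(?w has_derivative (\<lambda>h. h *\<^sub>R (- v))) (at t within J)"
    using has_vector_derivative_diff[OF has_vector_derivative_const p, of q]
    by (simp add: has_vector_derivative_def)
  have "bounded_linear (\<lambda>A::real^3^3. A *v e)"
    unfolding linear_conv_bounded_linear[symmetric]
    by (rule linearI) (simp_all add: matrix_vector_mult_add_rdistrib scaleR_matrix_vector_assoc)
  then have "(?y has_vector_derivative (?R ** skew \<omega>) *v e) (at t within J)"
    by (rule bounded_linear.has_vector_derivative[OF _ R])
  \<comment> \<open>Anticommutativity of the cross product moves \<open>\<omega>\<close> to the
    right, which produces the minus sign and the matrix \<open>skew e\<close> of the second
    constraint.\<close>
  moreover have "(?R ** skew \<omega>) *v e = ?y'"
    by (simp add: matrix_vector_mul_assoc[symmetric] skew_mult_vec cross_skew[of \<omega> e]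
        linear_neg[OF matrix_vector_mul_linear])
  ultimately have y': "(?y has_derivative (\<lambda>h. h *\<^sub>R ?y')) (at t within J)"
    by (simp add: has_vector_derivative_def)
  have inner': "((\<lambda>s. ?w s \<bullet> ?y s) has_real_derivative (?w t \<bullet> ?y' - v \<bullet> ?y t)) (at t within J)"
    unfolding has_field_derivative_def
    by (rule has_derivative_eq_rhs[OF has_derivative_inner[OF w' y']])
       (auto simp: fun_eq_iff algebra_simps)
  have "((\<lambda>s. norm (?w s)) has_derivative (\<lambda>h. h *\<^sub>R (- v) \<bullet> sgn (?w t))) (at t within J)"
    using has_derivative_compose[OF w' has_derivative_norm[of "?w t"]] n by simp
  then have norm': "((\<lambda>s. norm (?w s)) has_real_derivative - (v \<bullet> ?w t) / ?n) (at t within J)"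
    unfolding has_field_derivative_def
    by (rule has_derivative_eq_rhs) (auto simp: fun_eq_iff sgn_div_norm divide_inverse)
  have D: "((\<lambda>s. (?w s \<bullet> ?y s) / norm (?w s) - cos \<psi>) has_real_derivative
      ((?w t \<bullet> ?y' - v \<bullet> ?y t) * ?n + (?w t \<bullet> ?y t) * (v \<bullet> ?w t) / ?n) / (?n * ?n)) (at t within J)"
    using DERIV_diff[OF DERIV_divide[OF inner' norm'] DERIV_const] n by simp
  let ?b = "bearing q (fst (x t))"
  have adjoint: "e \<bullet> (transpose ?R *v z) = ?y t \<bullet> z" for z
    by (metis dot_lmul_matrix inner_commute transpose_matrix_vector)
  have wb: "?w t = ?n *\<^sub>R ?b" using n by (simp add: bearing_def)
  \<comment> \<open>The scalar core of the regrouping: \<open>vy\<close>, \<open>bv\<close>,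
    \<open>yb\<close> and \<open>c\<close> stand for v . y, \<beta> . v, \<beta> . y and \<beta> .
    y', and \<open>vy - bv * yb\<close> is y . (P v) for the projection P orthogonal to
    \<beta>.\<close>
  have quotient: "- (1 / n) * (vy - bv * yb) + c
      = ((n * c - vy) * n + (n * yb) * (n * bv) / n) / (n * n)"
    if "n > 0" for n vy bv yb c :: real
    using that by (simp add: field_simps)
  have "- (1 / feature_dist q (fst (x t)))
          * (e \<bullet> (transpose ?R *v (transpose (proj_mat ?b) *v v))) - ?b \<bullet> (?R *v (skew e *v \<omega>))
     = - (1 / ?n) * (v \<bullet> ?y t - (?b \<bullet> v) * (?b \<bullet> ?y t)) + ?b \<bullet> ?y'"
    by (simp add: transpose_proj_mat proj_mat_mult_vec adjoint inner_diff_right feature_dist_def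
        inner_commute del: transpose_matrix_vector)
  also have "\<dots> = ((?n * (?b \<bullet> ?y') - v \<bullet> ?y t) * ?n
      + (?n * (?b \<bullet> ?y t)) * (?n * (?b \<bullet> v)) / ?n) / (?n * ?n)"
    by (rule quotient[OF n])
  \<comment> \<open>Only the three inner products with \<open>?w t\<close> are rewritten; its
    occurrences inside norms have to stay.\<close>
  also have "\<dots> = ((?w t \<bullet> ?y' - v \<bullet> ?y t) * ?n + (?w t \<bullet> ?y t) * (v \<bullet> ?w t) / ?n) / (?n * ?n)"
    unfolding inner_commute[of v "?w t"] by (subst (4 5 6) wb) (simp only: inner_scaleR_left)
  finally have "- (1 / feature_dist q (fst (x t)))
          * (e \<bullet> (transpose ?R *v (transpose (proj_mat ?b) *v v))) - ?b \<bullet> (?R *v (skew e *v \<omega>))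
     = ((?w t \<bullet> ?y' - v \<bullet> ?y t) * ?n + (?w t \<bullet> ?y t) * (v \<bullet> ?w t) / ?n) / (?n * ?n)" .
  moreover have "(\<lambda>s. barrier q e \<psi> (x s)) = (\<lambda>s. (?w s \<bullet> ?y s) / norm (?w s) - cos \<psi>)"
    by (simp add: barrier_def case_prod_beta bearing_def)
  ultimately show ?thesis using D by (simp only:)
qed

text \<open>The expression is affine in \<open>r\<close>, so its minimum over the interval lies at
  an endpoint; the sign of \<open>c\<close> decides which one.\<close>

lemma decay_coefficient_pos:
  fixes r c \<gamma>\<^sub>0 d\<^sub>m d\<^sub>M :: real
  assumes "\<gamma>\<^sub>0 > 0" "d\<^sub>m < 1" "1 < d\<^sub>M" "d\<^sub>m \<le> r" "r \<le> d\<^sub>M"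
    and "\<gamma>\<^sub>0 / (1 - d\<^sub>M) < c" "c < \<gamma>\<^sub>0 / (1 - d\<^sub>m)"
  shows "\<gamma>\<^sub>0 + c * (r - 1) > 0"
proof -
  \<comment> \<open>Each bound on \<open>c\<close> settles one endpoint. Clearing the negative
    denominator \<open>1 - d\<^sub>M\<close> reverses the inequality, so the lower bound on
    \<open>c\<close> serves \<open>d\<^sub>M\<close> and the upper bound serves
    \<open>d\<^sub>m\<close>.\<close>
  have "\<gamma>\<^sub>0 + c * (d\<^sub>M - 1) > 0" "\<gamma>\<^sub>0 + c * (d\<^sub>m - 1) > 0"
    using assms by (simp_all add: field_simps)
  moreover have "\<gamma>\<^sub>0 + c * (r - 1) \<ge> \<gamma>\<^sub>0 + c * (d\<^sub>m - 1) \<or> \<gamma>\<^sub>0 + c * (r - 1) \<ge> \<gamma>\<^sub>0 + c * (d\<^sub>M - 1)"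
  proof (cases "c \<ge> 0")
    case True
    then have "c * (d\<^sub>m - 1) \<le> c * (r - 1)" using assms by (intro mult_left_mono) auto
    then show ?thesis by simp
  next
    case False
    then have "c * (d\<^sub>M - 1) \<le> c * (r - 1)" using assms by (intro mult_left_mono_neg) auto
    then show ?thesis by simp
  qed
  ultimately show ?thesis by linarith
qed

text \<open>Multiplying the rate by \<open>r > 0\<close> turns \<open>A / d\<close> into
  \<open>A / k\<close>, so both constraints apply and leave at least
  \<open>- (\<gamma>\<^sub>0 + c\<^sub>2 * (r - 1)) * g\<close>. Here \<open>k\<close> is the
  estimated distance and \<open>g\<close> the value of \<gamma> at the barrier.\<close>

lemma barrier_rate_nonneg:
  fixes A B g r d k :: real
  assumes "d > 0" "r > 0" "r = d / k"
    and "- (1 / k) * A + c\<^sub>1 * g \<ge> 0" "- B + c\<^sub>2 * g \<ge> 0"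
    and "c\<^sub>1 + c\<^sub>2 = \<gamma>\<^sub>0" "\<gamma>\<^sub>0 + c\<^sub>2 * (r - 1) > 0" "g \<le> 0"
  shows "- (1 / d) * A - B \<ge> 0"
proof -
  \<comment> \<open>Division by zero yields 0 in HOL, so \<open>k = 0\<close> would force
    \<open>r = 0\<close>.\<close>
  have "k \<noteq> 0" using assms by auto
  then have "- (1 / d) * A * r = - (1 / k) * A" using assms by simp
  moreover have "- B * r + c\<^sub>2 * g * r \<ge> 0"
    using mult_nonneg_nonneg[OF assms(5), of r] assms(2) by (simp add: algebra_simps)
  moreover have "(\<gamma>\<^sub>0 + c\<^sub>2 * (r - 1)) * g \<le> 0" using assms by (simp add: mult_nonneg_nonpos)
  moreover have "c\<^sub>1 * g = \<gamma>\<^sub>0 * g - c\<^sub>2 * g"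
    unfolding assms(6)[symmetric] by (simp add: algebra_simps)
  ultimately have "(- (1 / d) * A - B) * r \<ge> 0"
    using assms(4) by (simp add: algebra_simps)
  then show ?thesis using assms(2) by (simp add: zero_le_mult_iff)
qed

theorem theorem2:
  fixes q e\<^sub>c :: "real^3"
    and \<psi>\<^sub>F \<gamma>\<^sub>0 d\<^sub>m d\<^sub>M :: real
    and \<gamma> :: "real \<Rightarrow> real"
    and dhat :: "real^3 \<Rightarrow> real \<Rightarrow> real"
    and ustar :: "state \<Rightarrow> control"
  assumes "norm e\<^sub>c = 1"
    and "0 < \<psi>\<^sub>F" and "\<psi>\<^sub>F < pi / 2"
    and "class_K \<gamma>"
    and "\<gamma>\<^sub>0 > 0" and "d\<^sub>m > 0" and "d\<^sub>M > 0" and "d\<^sub>m < 1" and "1 < d\<^sub>M"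
  shows "forward_invariant (safe_set q e\<^sub>c \<psi>\<^sub>F)
    {(J, x). \<exists>u. kinematic_trajectory q J x u \<and>
       (\<forall>t\<in>J. \<exists>z. qp_constraints q e\<^sub>c \<psi>\<^sub>F \<gamma> dhat \<gamma>\<^sub>0 d\<^sub>m d\<^sub>M (x t) t z) \<and>
       (\<forall>t\<in>J. \<exists>c\<^sub>1 c\<^sub>2. qp_solution q e\<^sub>c \<psi>\<^sub>F \<gamma> dhat \<gamma>\<^sub>0 d\<^sub>m d\<^sub>M ustar (x t) t (u t, c\<^sub>1, c\<^sub>2)) \<and>
       (\<forall>t\<in>J. rel_error q dhat (fst (x t)) t \<in> {d\<^sub>m..d\<^sub>M})}"
  unfolding forward_invariant_def
proof clarify
  fix J x u t
  assume traj: "kinematic_trajectory q J x u"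
    and sol: "\<forall>t\<in>J. \<exists>c\<^sub>1 c\<^sub>2. qp_solution q e\<^sub>c \<psi>\<^sub>F \<gamma> dhat \<gamma>\<^sub>0 d\<^sub>m d\<^sub>M ustar (x t) t (u t, c\<^sub>1, c\<^sub>2)"
    and err: "\<forall>t\<in>J. rel_error q dhat (fst (x t)) t \<in> {d\<^sub>m..d\<^sub>M}"
    and x0: "x 0 \<in> safe_set q e\<^sub>c \<psi>\<^sub>F" and t: "t \<in> J"
  let ?h = "\<lambda>s. barrier q e\<^sub>c \<psi>\<^sub>F (x s)"
  let ?D = "\<lambda>s. - (1 / feature_dist q (fst (x s)))
          * (e\<^sub>c \<bullet> (transpose (snd (x s)) *v (transpose (proj_mat (bearing q (fst (x s)))) *v fst (u s))))
      - bearing q (fst (x s)) \<bullet> (snd (x s) *v (skew e\<^sub>c *v snd (u s)))"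
  have J: "{0..t} \<subseteq> J" and t0: "t \<ge> 0"
    using traj t mem_is_interval_1_I[of J 0 t] unfolding kinematic_trajectory_def by auto
  have ne: "fst (x s) \<noteq> q" if "s \<in> J" for s
    using traj that by (auto simp: kinematic_trajectory_def state_space_def case_prod_beta)
  have deriv: "(?h has_real_derivative ?D s) (at s within J)" if "s \<in> J" for s
    using traj ne that unfolding kinematic_trajectory_def by (intro barrier_has_derivative) auto
  have rate: "?D s \<ge> 0" if s: "s \<in> J" and neg: "?h s < 0" for s
  proof -
    let ?r = "rel_error q dhat (fst (x s)) s"
    \<comment> \<open>A minimizer is in particular a feasible point.\<close>
    obtain c\<^sub>1 c\<^sub>2 where "qp_constraints q e\<^sub>c \<psi>\<^sub>F \<gamma> dhat \<gamma>\<^sub>0 d\<^sub>m d\<^sub>M (x s) s (u s, c\<^sub>1, c\<^sub>2)"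
      using sol s unfolding qp_solution_def is_arg_min_def by blast
    then have c: "- (1 / dhat (fst (x s)) s) * (e\<^sub>c \<bullet> (transpose (snd (x s)) *v (transpose (proj_mat (bearing q (fst (x s)))) *v fst (u s))))
          + c\<^sub>1 * \<gamma> (?h s) \<ge> 0"
        "- (bearing q (fst (x s)) \<bullet> (snd (x s) *v (skew e\<^sub>c *v snd (u s)))) + c\<^sub>2 * \<gamma> (?h s) \<ge> 0"
        "c\<^sub>1 + c\<^sub>2 = \<gamma>\<^sub>0" "\<gamma>\<^sub>0 / (1 - d\<^sub>M) < c\<^sub>2" "c\<^sub>2 < \<gamma>\<^sub>0 / (1 - d\<^sub>m)"
      by (auto simp: qp_constraints_def case_prod_beta)
    have r: "d\<^sub>m \<le> ?r" "?r \<le> d\<^sub>M" using err s by auto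
    show ?thesis
    proof (rule barrier_rate_nonneg[OF _ _ _ c(1,2,3)])
      show "feature_dist q (fst (x s)) > 0" using ne[OF s] by (simp add: feature_dist_def)
      show "?r > 0" using r assms(6) by simp
      show "?r = feature_dist q (fst (x s)) / dhat (fst (x s)) s" by (simp add: rel_error_def)
      show "\<gamma>\<^sub>0 + c\<^sub>2 * (?r - 1) > 0"
        by (rule decay_coefficient_pos[OF assms(5,8,9) r c(4,5)])
      show "\<gamma> (?h s) \<le> 0"
        using assms(4) neg unfolding class_K_def by (metis less_imp_le strict_monoD)
    qed
  qed
  have "?h t \<ge> 0"
  proof (rule nonneg_if_nondecreasing_while_negative[OF t0])
    show "continuous_on {0..t} ?h"
      by (rule continuous_on_subset[OF DERIV_continuous_on[OF deriv] J])
    show "?h 0 \<ge> 0" using x0 by (simp add: safe_set_def)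
    fix s assume s: "0 < s" "s < t" "?h s < 0"
    have "s \<in> J" using s J by auto
    \<comment> \<open>Derivatives along the trajectory are relative to \<open>J\<close>, but
      \<open>s\<close> is interior to \<open>{0..t}\<close> and hence to \<open>J\<close>, so the
      derivative there is two-sided.\<close>
    moreover have "at s within J = at s"
      using s interior_mono[OF J] by (intro at_within_interior) auto
    ultimately show "\<exists>D\<ge>0. (?h has_real_derivative D) (at s)"
      using deriv[of s] rate[of s] s(3) by (intro exI[of _ "?D s"]) simp
  qed
  then show "x t \<in> safe_set q e\<^sub>c \<psi>\<^sub>F"
    using traj t unfolding safe_set_def kinematic_trajectory_def by blast
qed

end
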